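(* Suppose that the power series $B(x,P) = \sum_{k=0}^\infty\sum_{\ell=0}^\infty b_{k,\ell}\, x^k P^\ell$ (with coefficients as defined in the context) satisfies: (i) it converges for all $0 \le x < \frac12$, $x \le P \le \frac12$; (ii) $B(x,P) \ge 0$ for all $0 \le x < \frac12$, $x \le P \le \frac12$; and (iii) $\int_0^P B(x,P)\,dx = \frac{1}{P+1} - \sqrt{\frac{1-2P}{1+2P}}$ for all $0 \le P \le \frac12$. Let $n \ge 2$, let $0 \le p_1 < p_2 < \cdots < p_n \le 1$ be the blue-fractions of $n$ bichromatic urns, and let $\epsilon = \min_{1\le i\le n-1}(p_{i+1}-p_i)$. Then there exists a symmetric voting scheme for the Condorcet election such that, for every $\eta\in(0,1)$, with $O\left(\frac{\ln \eta^{-1}}{\epsilon^2}\right)$ voters (absolute implicit constant), whichever urn is the correct one, the correct urn wins the election with probability at least $1-\eta$.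
   Context: Coefficients: for integers $k,\ell \ge 0$ let $c_{k,\ell} = (-1)^{k+\ell}\binom{k+\ell}{k} - \frac{(-1)^{\ell}\binom{k+\ell}{k} + (-1)^{k+\ell}(\ell+1)}{k+\ell+2}$. Define $b_{k,\ell}$ by $b_{k,\ell} = 0$ if $k<0$ or $\ell<0$, and for $k,\ell\ge 0$, $b_{k,\ell} = (k+1)\left(x_{k-1,\ell} + y_{k-1,\ell} - c_{k+1,\ell}\right)$, where $x_{k,\ell} = \sum_{i,j\ge 0,\ i+j\le k}\frac{b_{i,k-i-j}\, b_{j,\ell}}{(i+1)(i+j+2)}$ and $y_{k,\ell} = \sum_{i=0}^{k}(-1)^{k-i}\frac{b_{i,\ell}}{i+1}$ (empty sums are $0$; the recursion is well defined when computed in order of increasing $k+\ell$, then increasing $k$). Voting model: urn $i$ has a fraction $p_i$ of blue and $1-p_i$ of red balls. One urn is chosen (adversarially) as the correct urn; each of $m$ voters independently draws one ball (with replacement) from it and observes only its color. In a Condorcet election each voter returns a total ordering (ranking) of the $n$ urns, chosen by a possibly randomized rule depending on the observed color (independent randomness across voters); the scheme is symmetric if all voters use the same rule, and the rule may depend on $p_1,\dots,p_n$ but not on which urn is correct. Urn $i$ beats urn $j$ in a run-off if more than half of the voters rank $i$ higher than $j$; urn $i$ wins the election if it beats every other urn $j\neq i$.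
   Formalization: The number of voters is bounded by C·max(1, ln(1/η))/ε² instead of C·ln(1/η)/ε², since for η close to 1 the latter would force zero voters, and then no urn wins; for η ≤ 1/2 the two bounds agree up to a constant. *)

theory Defs
  imports "HOL-Analysis.Analysis" "HOL-Probability.Probability" "HOL-Probability.Product_PMF"
begin

definition c_coeff :: "nat \<Rightarrow> nat \<Rightarrow> real" where
  "c_coeff k l = (-1) ^ (k + l) * real ((k + l) choose k)
     - ((-1) ^ l * real ((k + l) choose k) + (-1) ^ (k + l) * (real l + 1)) / (real k + real l + 2)"

text \<open>
  The coefficients with a negative index are 0, and the sums with first index \<open>-1\<close> are empty, so
  natural-number indices suffice; \<open>b_coeff 0 l\<close> is the general formula with both sums equal to 0.
\<close>

function b_coeff :: "nat \<Rightarrow> nat \<Rightarrow> real"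
  and x_coeff :: "nat \<Rightarrow> nat \<Rightarrow> real"
  and y_coeff :: "nat \<Rightarrow> nat \<Rightarrow> real"
where
  "b_coeff 0 l = - c_coeff 1 l"
| "b_coeff (Suc k) l = (real (Suc k) + 1) * (x_coeff k l + y_coeff k l - c_coeff (Suc k + 1) l)"
| "x_coeff k l = (\<Sum>i\<in>{0..k}. \<Sum>j\<in>{0..k - i}.
      b_coeff i (k - i - j) * b_coeff j l / ((real i + 1) * (real i + real j + 2)))"
| "y_coeff k l = (\<Sum>i\<in>{0..k}. (-1) ^ (k - i) * b_coeff i l / (real i + 1))"
  by pat_completeness auto
termination
  by (relation "Wellfounded.measure (case_sum (\<lambda>(k, l). 2 * (k + l))
        (case_sum (\<lambda>(k, l). 2 * (k + l) + 1) (\<lambda>(k, l). 2 * (k + l) + 1)))") auto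

declare b_coeff.simps [simp del] x_coeff.simps [simp del] y_coeff.simps [simp del]

definition B_term :: "real \<Rightarrow> real \<Rightarrow> nat \<times> nat \<Rightarrow> real" where
  "B_term x P = (\<lambda>(k, l). b_coeff k l * x ^ k * P ^ l)"

text \<open>
  Convergence of the double power series is unconditional (equivalently, absolute) convergence,
  i.e. \<open>B_term x P summable_on UNIV\<close>.
\<close>

definition B_series :: "real \<Rightarrow> real \<Rightarrow> real" where
  "B_series x P = infsum (B_term x P) UNIV"


text \<open>
  The urns are \<open>1, \<dots>, n\<close> and the voters are \<open>0, \<dots>, m - 1\<close>. A ranking \<open>r\<close> is a total order on the
  urns, where \<open>(i, j) \<in> r\<close> means that \<open>i\<close> is ranked at least as high as \<open>j\<close>. The observed colour is
  \<open>True\<close> for blue. A scheme assigns to every voter and observed colour a distribution on rankings.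
\<close>

type_synonym ranking = "(nat \<times> nat) set"
type_synonym scheme = "nat \<Rightarrow> bool \<Rightarrow> ranking pmf"

definition voting_scheme :: "nat \<Rightarrow> scheme \<Rightarrow> bool" where
  "voting_scheme n S \<longleftrightarrow> (\<forall>v col. \<forall>r\<in>set_pmf (S v col). linear_order_on {1..n} r)"

definition symmetric_scheme :: "scheme \<Rightarrow> bool" where
  "symmetric_scheme S \<longleftrightarrow> (\<forall>v w. S v = S w)"

text \<open>The joint law of the rankings of \<open>m\<close> voters when the correct urn has blue fraction \<open>q\<close>.\<close>

definition ballots :: "nat \<Rightarrow> scheme \<Rightarrow> real \<Rightarrow> (nat \<Rightarrow> ranking) pmf" where
  "ballots m S q = Pi_pmf {..<m} {} (\<lambda>v. bind_pmf (bernoulli_pmf q) (S v))"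

definition beats :: "nat \<Rightarrow> (nat \<Rightarrow> ranking) \<Rightarrow> nat \<Rightarrow> nat \<Rightarrow> bool" where
  "beats m R i j \<longleftrightarrow> real (card {v. v < m \<and> (i, j) \<in> R v}) > real m / 2"

definition wins_election :: "nat \<Rightarrow> nat \<Rightarrow> (nat \<Rightarrow> ranking) \<Rightarrow> nat \<Rightarrow> bool" where
  "wins_election n m R i \<longleftrightarrow> (\<forall>j\<in>{1..n}. j \<noteq> i \<longrightarrow> beats m R i j)"

definition min_gap :: "nat \<Rightarrow> (nat \<Rightarrow> real) \<Rightarrow> real" where
  "min_gap n p = Min ((\<lambda>i. p (i + 1) - p i) ` {1..n - 1})"

end

theory Submission
  imports Defs "HOL-Probability.Hoeffding"
begin

text \<open>
  A voter flips a fair coin. On heads the urns are ranked by increasing blue fraction if the ball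
  drawn is red and by decreasing blue fraction if it is blue, so if \<open>p a < p b\<close> and the correct urn
  has blue fraction \<open>q\<close>, urn \<open>a\<close> is ranked above \<open>b\<close> with probability \<open>1 - q\<close>. On tails the voter
  ignores the ball and uses a random ranking that puts \<open>a\<close> above \<open>b\<close> with probability
  \<open>(p a + p b) / 2\<close>. Overall \<open>a\<close> is above \<open>b\<close> with probability \<open>1/2 + (p a + p b - 2 * q) / 4\<close>, so
  that the correct urn \<open>i\<close> is above any other \<open>j\<close> with probability \<open>1/2 + \<bar>p i - p j\<bar> / 4\<close>.
  Since \<open>\<bar>p i - p j\<bar>\<close> grows linearly in \<open>\<bar>i - j\<bar>\<close>, the union bound over Hoeffding's inequality
  is dominated by a geometric series, and no factor depending on \<open>n\<close> is lost.
\<close>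

lemma prob_bind_bernoulli_pmf:
  assumes "0 \<le> q" "q \<le> 1"
  shows "measure_pmf.prob (bernoulli_pmf q \<bind> f) A =
    q * measure_pmf.prob (f True) A + (1 - q) * measure_pmf.prob (f False) A"
proof -
  have "measure_pmf.prob (bernoulli_pmf q \<bind> f) A =
      measure_pmf.expectation (bernoulli_pmf q) (\<lambda>b. measure_pmf.prob (f b) A)"
    unfolding measure_pmf_bind
    by (intro measure_pmf.measure_bind[where N = "count_space UNIV"])
       (auto simp: measure_pmf_in_subprob_algebra)
  then show ?thesis
    using assms by simp
qed

lemma prob_Pi_pmf_component:
  assumes "finite A" "a \<in> A"
  shows "measure_pmf.prob (Pi_pmf A dflt D) {f. f a \<in> X} = measure_pmf.prob (D a) X"
proof -
  have "measure_pmf.prob (D a) X = measure_pmf.prob (map_pmf (\<lambda>f. f a) (Pi_pmf A dflt D)) X"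
    using assms by (simp add: Pi_pmf_component)
  then show ?thesis
    by (simp add: vimage_def)
qed

lemma map_pmf_eq_bernoulli_pmf:
  "map_pmf P D = bernoulli_pmf (measure_pmf.prob D {x. P x})"
proof (rule pmf_eqI)
  fix b
  have "pmf (map_pmf P D) True = measure_pmf.prob D {x. P x}"
    by (simp add: pmf_map vimage_def)
  then show "pmf (map_pmf P D) b = pmf (bernoulli_pmf (measure_pmf.prob D {x. P x})) b"
    by (cases b) (simp_all add: pmf_False_conv_True)
qed

definition key_order :: "'a set \<Rightarrow> ('a \<Rightarrow> 'b::linorder) \<Rightarrow> 'a rel" where
  "key_order A f = relation_of (\<lambda>a b. f a \<le> f b) A"

lemma in_key_order_iff: "(a, b) \<in> key_order A f \<longleftrightarrow> a \<in> A \<and> b \<in> A \<and> f a \<le> f b"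
  by (auto simp: key_order_def relation_of_def)

lemma linear_order_on_key_order:
  assumes "inj_on f A"
  shows "linear_order_on A (key_order A f)"
  unfolding linear_order_on_def
proof
  show "partial_order_on A (key_order A f)"
    unfolding key_order_def
    by (rule partial_order_on_relation_ofI) (use inj_onD[OF assms] in auto)
  show "total_on A (key_order A f)"
    by (auto simp: total_on_def in_key_order_iff)
qed

lemma prob_linear_order_converse:
  assumes linear: "\<And>r. r \<in> set_pmf D \<Longrightarrow> linear_order_on A r"
    and "a \<in> A" "b \<in> A" "a \<noteq> b"
  shows "measure_pmf.prob D {r. (b, a) \<in> r} = 1 - measure_pmf.prob D {r. (a, b) \<in> r}"
proof -
  have "(b, a) \<in> r \<longleftrightarrow> (a, b) \<notin> r" if "r \<in> set_pmf D" for r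
    using linear[OF that] assms(2-4)
    by (auto simp: linear_order_on_def partial_order_on_def total_on_def dest: antisymD)
  then have "measure_pmf.prob D {r. (b, a) \<in> r} = measure_pmf.prob D {r. (a, b) \<notin> r}"
    by (intro measure_pmf.finite_measure_eq_AE) (auto simp: AE_measure_pmf_iff)
  also have "\<dots> = 1 - measure_pmf.prob D {r. (a, b) \<in> r}"
    using measure_pmf.prob_neg[of D "\<lambda>r. (a, b) \<in> r"] by simp
  finally show ?thesis .
qed

definition reflect_unless :: "('a \<Rightarrow> bool) \<Rightarrow> real \<Rightarrow> ('a \<Rightarrow> real) \<Rightarrow> 'a \<Rightarrow> real" where
  "reflect_unless draw c p a = (if draw a then p a else c - p a)"

lemma inj_on_reflect_unless:
  assumes "inj_on p A" "\<And>a. a \<in> A \<Longrightarrow> p a \<in> {0..1}" "c = 0 \<or> c = 2"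
  shows "inj_on (reflect_unless draw c p) A"
proof (rule inj_onI)
  fix a b
  assume in_A: "a \<in> A" "b \<in> A" and "reflect_unless draw c p a = reflect_unless draw c p b"
  then consider (same) "p a = p b" | (reflected) "p a + p b = c"
    by (auto simp: reflect_unless_def split: if_splits)
  then have "p a = p b"
  proof cases
    case reflected
    then show ?thesis
      using assms(2)[OF in_A(1)] assms(2)[OF in_A(2)] assms(3) by auto
  qed
  with \<open>inj_on p A\<close> show "a = b"
    using in_A by (rule inj_onD)
qed

text \<open>
  Small keys are ranked high and \<open>p\<close> takes values in \<open>[0, 1]\<close>, so reflecting the urns that gave red
  moves them below all others (key \<open>2 - p a\<close>) or above all others (key \<open>- p a\<close>). If \<open>p a < p b\<close>,
  then \<open>a\<close> is above \<open>b\<close> iff \<open>a\<close> gave blue in the first case, and iff \<open>b\<close> gave blue in the second.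
\<close>

definition simulated_ranking :: "'a set \<Rightarrow> ('a \<Rightarrow> real) \<Rightarrow> 'a rel pmf" where
  "simulated_ranking A p = do {
     blue_on_top \<leftarrow> bernoulli_pmf (1/2);
     draw \<leftarrow> Pi_pmf A False (\<lambda>a. bernoulli_pmf (p a));
     return_pmf (key_order A (reflect_unless draw (if blue_on_top then 2 else 0) p))
   }"

lemma linear_order_on_simulated_ranking:
  assumes "inj_on p A" "\<And>a. a \<in> A \<Longrightarrow> p a \<in> {0..1}" "r \<in> set_pmf (simulated_ranking A p)"
  shows "linear_order_on A r"
  using assms
  by (auto simp: simulated_ranking_def intro!: linear_order_on_key_order inj_on_reflect_unless)

lemma prob_simulated_ranking:
  assumes "finite A" "a \<in> A" "b \<in> A" "p a \<in> {0..1}" "p b \<in> {0..1}" "p a < p b"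
  shows "measure_pmf.prob (simulated_ranking A p) {r. (a, b) \<in> r} = (p a + p b) / 2"
proof -
  let ?draws = "Pi_pmf A False (\<lambda>a. bernoulli_pmf (p a))"
  have above_iff_if_top: "(a, b) \<in> key_order A (reflect_unless draw 2 p) \<longleftrightarrow> draw a \<in> {True}"
    for draw
    using assms by (auto simp: in_key_order_iff reflect_unless_def)
  have above_iff_if_bottom: "(a, b) \<in> key_order A (reflect_unless draw 0 p) \<longleftrightarrow> draw b \<in> {True}"
    for draw
    using assms by (auto simp: in_key_order_iff reflect_unless_def)
  have draw_blue: "measure_pmf.prob ?draws {draw. draw x \<in> {True}} = p x"
    if "x \<in> A" "p x \<in> {0..1}" for x
    using prob_Pi_pmf_component[OF \<open>finite A\<close> \<open>x \<in> A\<close>, of False _ "{True}"] that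
    by (simp add: measure_pmf_single)
  show ?thesis
    using draw_blue[of a] draw_blue[of b] assms
    by (simp add: simulated_ranking_def prob_bind_bernoulli_pmf above_iff_if_top
        above_iff_if_bottom vimage_def flip: map_pmf_def)
qed

definition voter_rule :: "'a set \<Rightarrow> ('a \<Rightarrow> real) \<Rightarrow> bool \<Rightarrow> 'a rel pmf" where
  "voter_rule A p blue = do {
     heads \<leftarrow> bernoulli_pmf (1/2);
     if heads then return_pmf (key_order A (\<lambda>a. if blue then - p a else p a))
     else simulated_ranking A p
   }"

lemma linear_order_on_voter_rule:
  assumes "inj_on p A" "\<And>a. a \<in> A \<Longrightarrow> p a \<in> {0..1}" "r \<in> set_pmf (voter_rule A p blue)"
  shows "linear_order_on A r"
proof -
  have "inj_on (\<lambda>a. if blue then - p a else p a) A"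
    using \<open>inj_on p A\<close> by (auto simp: inj_on_def)
  then show ?thesis
    using assms linear_order_on_simulated_ranking[OF assms(1,2)]
    by (auto simp: voter_rule_def linear_order_on_key_order split: if_splits)
qed

lemma prob_voter_rule:
  assumes "finite A" "a \<in> A" "b \<in> A" "p a \<in> {0..1}" "p b \<in> {0..1}" "p a < p b" "q \<in> {0..1}"
  shows "measure_pmf.prob (bernoulli_pmf q \<bind> voter_rule A p) {r. (a, b) \<in> r} =
    1/2 + (p a + p b - 2 * q) / 4"
proof -
  have "measure_pmf.prob (voter_rule A p blue) {r. (a, b) \<in> r} =
      (if blue then 0 else 1/2) + (p a + p b) / 4" for blue
    using assms
    by (simp add: voter_rule_def prob_bind_bernoulli_pmf prob_simulated_ranking in_key_order_iff)
  then show ?thesis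
    using assms by (simp add: prob_bind_bernoulli_pmf field_simps)
qed

lemma prob_voter_rule_correct_urn:
  assumes "finite A" "inj_on p A" "\<And>a. a \<in> A \<Longrightarrow> p a \<in> {0..1}" "i \<in> A" "j \<in> A" "i \<noteq> j"
  shows "measure_pmf.prob (bernoulli_pmf (p i) \<bind> voter_rule A p) {r. (i, j) \<in> r} =
    1/2 + \<bar>p i - p j\<bar> / 4"
proof -
  let ?D = "bernoulli_pmf (p i) \<bind> voter_rule A p"
  consider (less) "p i < p j" | (greater) "p j < p i"
    using inj_onD[OF \<open>inj_on p A\<close>, of i j] assms by fastforce
  then show ?thesis
  proof cases
    case less
    then show ?thesis
      using assms by (simp add: prob_voter_rule)
  next
    case greater
    have "measure_pmf.prob ?D {r. (i, j) \<in> r} = 1 - measure_pmf.prob ?D {r. (j, i) \<in> r}"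
      using assms linear_order_on_voter_rule[OF assms(2,3)]
      by (intro prob_linear_order_converse) auto
    with greater show ?thesis
      using assms by (simp add: prob_voter_rule field_simps)
  qed
qed

lemma map_pmf_card_Pi_pmf:
  assumes "finite I"
  shows "map_pmf (\<lambda>f. card {i \<in> I. P (f i)}) (Pi_pmf I dflt (\<lambda>_. D)) =
    binomial_pmf (card I) (measure_pmf.prob D {x. P x})"
proof -
  have "binomial_pmf (card I) (measure_pmf.prob D {x. P x}) =
      map_pmf (\<lambda>f. card {i \<in> I. f i}) (Pi_pmf I (P dflt) (\<lambda>_. map_pmf P D))"
    using assms by (simp add: binomial_pmf_altdef'[where A = I] map_pmf_eq_bernoulli_pmf)
  also have "Pi_pmf I (P dflt) (\<lambda>_. map_pmf P D) = map_pmf ((\<circ>) P) (Pi_pmf I dflt (\<lambda>_. D))"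
    using assms by (rule Pi_pmf_map) simp
  finally show ?thesis
    by (simp add: pmf.map_comp o_def)
qed

lemma prob_binomial_pmf_le_half:
  assumes "0 \<le> \<delta>" "1/2 + \<delta> \<le> \<theta>" "\<theta> \<le> 1"
  shows "measure_pmf.prob (binomial_pmf m \<theta>) {k. real k \<le> real m / 2} \<le> exp (- 2 * real m * \<delta>\<^sup>2)"
proof (cases "m = 0")
  case False
  interpret binomial_distribution m \<theta>
    by standard (use assms in auto)
  have "real k / real m \<le> \<theta> - \<delta>" if "real k \<le> real m / 2" for k
  proof -
    have "real k / real m \<le> 1/2"
      using that False by (simp add: field_simps)
    then show ?thesis
      using assms(2) by linarith
  qed
  then have "measure_pmf.prob (binomial_pmf m \<theta>) {k. real k \<le> real m / 2} \<le>
      measure_pmf.prob (binomial_pmf m \<theta>) {k. real k / real m \<le> \<theta> - \<delta>}"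
    by (intro measure_pmf.finite_measure_mono) auto
  also have "\<dots> \<le> exp (- 2 * real m * \<delta>\<^sup>2)"
    using prob_le'[of \<delta>] False assms by simp
  finally show ?thesis .
qed simp

lemma prob_not_beats_le:
  assumes "0 \<le> \<delta>" "1/2 + \<delta> \<le> measure_pmf.prob D {r. (i, j) \<in> r}"
  shows "measure_pmf.prob (Pi_pmf {..<m} {} (\<lambda>_. D)) {R. \<not> beats m R i j} \<le>
    exp (- 2 * real m * \<delta>\<^sup>2)"
proof -
  let ?\<theta> = "measure_pmf.prob D {r. (i, j) \<in> r}"
  have "measure_pmf.prob (Pi_pmf {..<m} {} (\<lambda>_. D)) {R. \<not> beats m R i j} =
      measure_pmf.prob (binomial_pmf (card {..<m}) ?\<theta>) {k. real k \<le> real m / 2}"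
    by (subst map_pmf_card_Pi_pmf[symmetric, where dflt = "{}"])
       (auto simp: vimage_def beats_def not_less)
  also have "\<dots> \<le> exp (- 2 * real m * \<delta>\<^sup>2)"
    using prob_binomial_pmf_le_half[OF assms] by simp
  finally show ?thesis .
qed

lemma prob_not_wins_election_le:
  "measure_pmf.prob M {R. \<not> wins_election n m R i} \<le>
    (\<Sum>j\<in>{1..n} - {i}. measure_pmf.prob M {R. \<not> beats m R i j})"
proof -
  have "{R. \<not> wins_election n m R i} = (\<Union>j\<in>{1..n} - {i}. {R. \<not> beats m R i j})"
    by (auto simp: wins_election_def)
  then show ?thesis
    by (simp add: measure_pmf.finite_measure_subadditive_finite)
qed

lemma sum_powers_inj_on_le:
  fixes r :: real
  assumes "0 \<le> r" "r < 1" "finite A" "inj_on d A" "0 \<notin> d ` A"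
  shows "(\<Sum>a\<in>A. r ^ d a) \<le> r / (1 - r)"
proof -
  have "1 + (\<Sum>a\<in>A. r ^ d a) = (\<Sum>k\<in>insert 0 (d ` A). r ^ k)"
    using assms by (simp add: sum.reindex)
  also have "\<dots> \<le> (\<Sum>k. r ^ k)"
    using assms by (intro sum_le_suminf) (auto simp: summable_geometric)
  also have "\<dots> = 1 + r / (1 - r)"
    using assms by (simp add: suminf_geometric field_simps)
  finally show ?thesis by simp
qed

lemma sum_powers_dist_le:
  fixes r :: real and i :: nat
  assumes "0 \<le> r" "r < 1" "finite A"
  shows "(\<Sum>j\<in>A - {i}. r ^ nat \<bar>int i - int j\<bar>) \<le> 2 * (r / (1 - r))"
proof -
  let ?S = "\<lambda>A. \<Sum>j\<in>A. r ^ nat \<bar>int i - int j\<bar>"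
  have "A - {i} = A \<inter> {..<i} \<union> A \<inter> {i<..}"
    by auto
  also have "?S (A \<inter> {..<i} \<union> A \<inter> {i<..}) = ?S (A \<inter> {..<i}) + ?S (A \<inter> {i<..})"
    by (rule sum.union_disjoint) (use assms in auto)
  also have "?S (A \<inter> {..<i}) \<le> r / (1 - r)"
    using assms by (intro sum_powers_inj_on_le) (auto simp: inj_on_def)
  also have "?S (A \<inter> {i<..}) \<le> r / (1 - r)"
    using assms by (intro sum_powers_inj_on_le) (auto simp: inj_on_def)
  finally show ?thesis by simp
qed

lemma min_gap_pos:
  assumes "2 \<le> n" "strict_mono_on {1..n} p"
  shows "0 < min_gap n p"
proof -
  have "0 < p (i + 1) - p i" if "i \<in> {1..n - 1}" for i
    using strict_mono_onD[OF assms(2), of i "i + 1"] that by auto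
  with assms(1) show ?thesis
    unfolding min_gap_def by (subst Min_gr_iff) auto
qed

lemma min_gap_mult_le_diff:
  assumes "1 \<le> i" "i \<le> j" "j \<le> n"
  shows "real (j - i) * min_gap n p \<le> p j - p i"
  using \<open>i \<le> j\<close> \<open>j \<le> n\<close>
proof (induction j rule: dec_induct)
  case (step k)
  have "min_gap n p \<le> p (k + 1) - p k"
    unfolding min_gap_def using step assms by (intro Min_le) auto
  then show ?case
    using step by (auto simp: algebra_simps Suc_diff_le)
qed simp

lemma min_gap_mult_dist_le:
  assumes "i \<in> {1..n}" "j \<in> {1..n}"
  shows "real (nat \<bar>int i - int j\<bar>) * min_gap n p \<le> \<bar>p i - p j\<bar>"
proof (cases "i \<le> j")
  case True
  then show ?thesis
    using min_gap_mult_le_diff[of i j n p] assms by (simp add: nat_diff_distrib')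
next
  case False
  then show ?thesis
    using min_gap_mult_le_diff[of j i n p] assms by (simp add: nat_diff_distrib')
qed

lemma exp_neg_square_diff_le_power_dist:
  assumes "i \<in> {1..n}" "j \<in> {1..n}" "0 \<le> min_gap n p" "0 \<le> c"
  shows "exp (- (c * (p i - p j)\<^sup>2)) \<le> exp (- (c * (min_gap n p)\<^sup>2)) ^ nat \<bar>int i - int j\<bar>"
proof -
  define k where "k = nat \<bar>int i - int j\<bar>"
  have "real k * (min_gap n p)\<^sup>2 \<le> (real k)\<^sup>2 * (min_gap n p)\<^sup>2"
    by (intro mult_right_mono) (auto simp: power2_eq_square simp flip: of_nat_mult)
  also have "\<dots> = (real k * min_gap n p)\<^sup>2"
    by (simp add: power_mult_distrib)
  also have "\<dots> \<le> \<bar>p i - p j\<bar>\<^sup>2"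
    using min_gap_mult_dist_le[OF assms(1,2), of p] assms(3) by (intro power_mono) (auto simp: k_def)
  finally have "c * (real k * (min_gap n p)\<^sup>2) \<le> c * (p i - p j)\<^sup>2"
    using assms(4) by (simp add: mult_left_mono)
  then have "exp (- (c * (p i - p j)\<^sup>2)) \<le> exp (real k * - (c * (min_gap n p)\<^sup>2))"
    by (simp add: mult.left_commute)
  then show ?thesis
    by (simp only: exp_of_nat_mult k_def)
qed

lemma prob_not_wins_election_le_geometric:
  assumes "i \<in> {1..n}" "0 < min_gap n p" "0 \<le> \<kappa>"
    and bias: "\<And>j. j \<in> {1..n} \<Longrightarrow> j \<noteq> i \<Longrightarrow>
      1/2 + \<kappa> * \<bar>p i - p j\<bar> \<le> measure_pmf.prob D {r. (i, j) \<in> r}"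
    and r_def: "r = exp (- (2 * real m * \<kappa>\<^sup>2 * (min_gap n p)\<^sup>2))" and "r < 1"
  shows "measure_pmf.prob (Pi_pmf {..<m} {} (\<lambda>_. D)) {R. \<not> wins_election n m R i} \<le>
    2 * (r / (1 - r))"
proof -
  let ?M = "Pi_pmf {..<m} {} (\<lambda>_. D)"
  have "measure_pmf.prob ?M {R. \<not> beats m R i j} \<le> r ^ nat \<bar>int i - int j\<bar>"
    if "j \<in> {1..n} - {i}" for j
  proof -
    have "measure_pmf.prob ?M {R. \<not> beats m R i j} \<le> exp (- 2 * real m * (\<kappa> * \<bar>p i - p j\<bar>)\<^sup>2)"
      using bias[of j] that assms(3) by (intro prob_not_beats_le) auto
    also have "\<dots> = exp (- (2 * real m * \<kappa>\<^sup>2 * (p i - p j)\<^sup>2))"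
      by (simp add: power_mult_distrib)
    also have "\<dots> \<le> r ^ nat \<bar>int i - int j\<bar>"
      unfolding r_def using assms(1,2) that by (intro exp_neg_square_diff_le_power_dist) auto
    finally show ?thesis .
  qed
  then have "measure_pmf.prob ?M {R. \<not> wins_election n m R i} \<le>
      (\<Sum>j\<in>{1..n} - {i}. r ^ nat \<bar>int i - int j\<bar>)"
    by (intro order.trans[OF prob_not_wins_election_le] sum_mono)
  also have "\<dots> \<le> 2 * (r / (1 - r))"
    using r_def \<open>r < 1\<close> by (intro sum_powers_dist_le) auto
  finally show ?thesis .
qed

lemma prob_wins_election_voter_rule_ge:
  assumes "i \<in> {1..n}" "inj_on p {1..n}" "\<And>a. a \<in> {1..n} \<Longrightarrow> p a \<in> {0..1}" "0 < min_gap n p"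
    and "exp (- (real m * (min_gap n p)\<^sup>2 / 8)) \<le> \<eta> / 4" "\<eta> < 1"
  shows "1 - \<eta> \<le>
    measure_pmf.prob (ballots m (\<lambda>_. voter_rule {1..n} p) (p i)) {R. wins_election n m R i}"
proof -
  define r where "r = exp (- (2 * real m * (1/4)\<^sup>2 * (min_gap n p)\<^sup>2))"
  let ?M = "ballots m (\<lambda>_. voter_rule {1..n} p) (p i)"
  have r_bounds: "0 < r" "r \<le> \<eta> / 4"
    using assms(5) by (simp_all add: r_def power2_eq_square)
  have "1 - measure_pmf.prob ?M {R. wins_election n m R i} =
      measure_pmf.prob ?M {R. \<not> wins_election n m R i}"
    using measure_pmf.prob_neg[of ?M "\<lambda>R. wins_election n m R i"] by simp
  also have "\<dots> \<le> 2 * (r / (1 - r))"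
    unfolding ballots_def
    by (rule prob_not_wins_election_le_geometric[where \<kappa> = "1/4", OF assms(1,4) _ _ r_def])
       (use assms r_bounds prob_voter_rule_correct_urn[of "{1..n}" p] in auto)
  also have "r / (1 - r) \<le> (\<eta> / 4) / (1/2)"
    using r_bounds assms(6) by (intro frac_le) auto
  finally show ?thesis by simp
qed

lemma exists_number_of_voters:
  fixes \<epsilon> \<eta> :: real
  assumes "0 < \<epsilon>" "\<epsilon> \<le> 1" "0 < \<eta>"
  shows "\<exists>m::nat. real m \<le> 33 * (max 1 (ln (1 / \<eta>)) / \<epsilon>\<^sup>2) \<and>
    exp (- (real m * \<epsilon>\<^sup>2 / 8)) \<le> \<eta> / 4"
proof -
  define L where "L = max 1 (ln (1 / \<eta>))"
  define m where "m = nat \<lceil>32 * L / \<epsilon>\<^sup>2\<rceil>"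
  have "1 \<le> L" "- L \<le> ln \<eta>"
    using assms by (auto simp: L_def ln_div)
  have pos: "0 < 32 * L / \<epsilon>\<^sup>2"
    using assms \<open>1 \<le> L\<close> by simp
  have "real m \<le> 32 * L / \<epsilon>\<^sup>2 + 1"
    using pos unfolding m_def by linarith
  also have "1 \<le> L / \<epsilon>\<^sup>2"
    using assms \<open>1 \<le> L\<close> power_le_one[of \<epsilon> 2] by simp
  finally have upper: "real m \<le> 33 * (L / \<epsilon>\<^sup>2)"
    by simp
  have "32 * L / \<epsilon>\<^sup>2 \<le> real m"
    using pos by (simp add: m_def)
  then have "exp (- (real m * \<epsilon>\<^sup>2 / 8)) \<le> exp (ln \<eta> - 3)"
    using assms \<open>1 \<le> L\<close> \<open>- L \<le> ln \<eta>\<close> by (simp add: field_simps)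
  also have "\<dots> = \<eta> / exp 3"
    using assms by (simp add: exp_diff)
  also have "\<dots> \<le> \<eta> / 4"
    using assms exp_ge_add_one_self[of 3] by (intro divide_left_mono) auto
  finally show ?thesis
    using upper by (auto simp: L_def)
qed

theorem theorem8:
  assumes converges: "\<And>x P :: real. 0 \<le> x \<Longrightarrow> x < 1/2 \<Longrightarrow> x \<le> P \<Longrightarrow> P \<le> 1/2
      \<Longrightarrow> B_term x P summable_on UNIV"
    and nonneg: "\<And>x P :: real. 0 \<le> x \<Longrightarrow> x < 1/2 \<Longrightarrow> x \<le> P \<Longrightarrow> P \<le> 1/2 \<Longrightarrow> 0 \<le> B_series x P"
    and integral: "\<And>P :: real. 0 \<le> P \<Longrightarrow> P \<le> 1/2
      \<Longrightarrow> ((\<lambda>x. B_series x P) has_integral (1 / (P + 1) - sqrt ((1 - 2*P) / (1 + 2*P)))) {0..P}"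
  shows "\<exists>C > 0 :: real. \<forall>(n :: nat) (p :: nat \<Rightarrow> real).
      2 \<le> n \<longrightarrow> 0 \<le> p 1 \<longrightarrow> strict_mono_on {1..n} p \<longrightarrow> p n \<le> 1 \<longrightarrow>
      (\<exists>S. voting_scheme n S \<and> symmetric_scheme S \<and>
        (\<forall>\<eta> :: real. 0 < \<eta> \<longrightarrow> \<eta> < 1 \<longrightarrow>
          (\<exists>m :: nat. real m \<le> C * (max 1 (ln (1 / \<eta>)) / (min_gap n p)\<^sup>2) \<and>
            (\<forall>i\<in>{1..n}.
              measure_pmf.prob (ballots m S (p i)) {R. wins_election n m R i} \<ge> 1 - \<eta>))))"
proof (intro exI[of _ "33::real"] conjI allI impI)
  fix n :: nat and p :: "nat \<Rightarrow> real"
  assume n: "2 \<le> n" and "0 \<le> p 1" and mono: "strict_mono_on {1..n} p" and "p n \<le> 1"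
  have inj: "inj_on p {1..n}"
    using mono by (rule strict_mono_on_imp_inj_on)
  have range: "p i \<in> {0..1}" if "i \<in> {1..n}" for i
    using strict_mono_on_leD[OF mono, of 1 i] strict_mono_on_leD[OF mono, of i n] that
      \<open>0 \<le> p 1\<close> \<open>p n \<le> 1\<close> by auto
  have gap: "0 < min_gap n p" "min_gap n p \<le> 1"
    using min_gap_pos[OF n mono] min_gap_mult_le_diff[of 1 2 n p] range[of 1] range[of 2] n by auto
  let ?S = "\<lambda>_. voter_rule {1..n} p"
  have "voting_scheme n ?S" "symmetric_scheme ?S"
    using linear_order_on_voter_rule[OF inj range]
    by (auto simp: voting_scheme_def symmetric_scheme_def)
  moreover have "\<exists>m. real m \<le> 33 * (max 1 (ln (1 / \<eta>)) / (min_gap n p)\<^sup>2) \<and>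
      (\<forall>i\<in>{1..n}. 1 - \<eta> \<le> measure_pmf.prob (ballots m ?S (p i)) {R. wins_election n m R i})"
    if "0 < \<eta>" "\<eta> < 1" for \<eta> :: real
    using exists_number_of_voters[OF gap \<open>0 < \<eta>\<close>]
      prob_wins_election_voter_rule_ge[OF _ inj range gap(1) _ \<open>\<eta> < 1\<close>] by blast
  ultimately show "\<exists>S. voting_scheme n S \<and> symmetric_scheme S \<and>
      (\<forall>\<eta> :: real. 0 < \<eta> \<longrightarrow> \<eta> < 1 \<longrightarrow>
        (\<exists>m :: nat. real m \<le> 33 * (max 1 (ln (1 / \<eta>)) / (min_gap n p)\<^sup>2) \<and>
          (\<forall>i\<in>{1..n}.
            measure_pmf.prob (ballots m S (p i)) {R. wins_election n m R i} \<ge> 1 - \<eta>)))"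
    by (intro exI[of _ ?S]) simp
qed simp

end
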